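(* Let $\sigma$ be a rational $n$-simplex in $\mathbb{R}^N$ with vertices $\alpha_0,\dots,\alpha_n$ and denominator $d$. Define, for $k=0,\dots,n$ and all $t\in\mathbb{R}$, \[ c_k(\sigma,t)=\frac{1}{n!\,d^k}\sum_{j=0}^{n}\#D\Bigl(\sigma,dj+d\bigl\{\tfrac{t}{d}\bigr\}\Bigr)\,s_{n-k}\Bigl(1-j-\bigl\{\tfrac{t}{d}\bigr\},\dots,n-j-\bigl\{\tfrac{t}{d}\bigr\}\Bigr), \] \[ c_k(\mathring{\sigma},t)=\frac{1}{n!\,d^k}\sum_{j=1}^{n+1}\#\bar D\Bigl(\sigma,dj+d\bigl\langle\tfrac{t}{d}\bigr\rangle\Bigr)\,s_{n-k}\Bigl(1-j-\bigl\langle\tfrac{t}{d}\bigr\rangle,\dots,n-j-\bigl\langle\tfrac{t}{d}\bigr\rangle\Bigr), \] and $L(\sigma,t)=\sum_{k=0}^n c_k(\sigma,t)t^k$, $L(\mathring{\sigma},t)=\sum_{k=0}^n c_k(\mathring{\sigma},t)t^k$ (so that $L(\sigma,t)=\#(t\sigma\cap\mathbb{Z}^N)$ for $t\ge0$ and $L(\mathring\sigma,t)=\#(t\mathring\sigma\cap\mathbb{Z}^N)$ for $t>0$). Then \[ L(\mathring{\sigma},-t)=(-1)^{\dim\sigma}L(\sigma,t)\quad\text{for all } t\in\mathbb{R}. \]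
   Context: $\mathring{\sigma}$ is the relative interior of $\sigma$. The denominator $d$ of a rational polytope is the smallest positive real number $d$ such that $d\sigma$ has all vertices in $\mathbb{Z}^N$. For real $x$, $\{x\}=x-\lfloor x\rfloor$ and $\langle x\rangle=x-\lceil x\rceil$. $s_j$ denotes the $j$-th elementary symmetric polynomial in $n$ variables ($s_0=1$). For real $\ell$, the determined sets are $D(\sigma,\ell)=\{\sum_{j=0}^n u_j\alpha_j\in\mathbb{Z}^N: 0\le u_j<d,\ \sum_j u_j=\ell\}$ and $\bar D(\sigma,\ell)=\{\sum_{j=0}^n v_j\alpha_j\in\mathbb{Z}^N: 0< v_j\le d,\ \sum_j v_j=\ell\}$. *)

theory Defs
  imports "HOL-Analysis.Analysis"
begin

definition int_points :: "(real ^ 'm) set" where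
  "int_points = {x. \<forall>i. x $ i \<in> \<int>}"

definition rat_points :: "(real ^ 'm) set" where
  "rat_points = {x. \<forall>i. x $ i \<in> \<rat>}"

definition vertices :: "'a::euclidean_space set \<Rightarrow> 'a set" where
  "vertices P = {v. v extreme_point_of P}"

definition rational_polytope :: "(real ^ 'm) set \<Rightarrow> bool" where
  "rational_polytope P \<longleftrightarrow> polytope P \<and> vertices P \<subseteq> rat_points"

text \<open>The denominator is the smallest positive real (not integer) \<open>d\<close> for which \<open>d P\<close> has integral
  vertices, so it may be less than 1. For \<open>P = {0}\<close> every positive \<open>d\<close> qualifies and there is
  no smallest one, hence a relation rather than a function.\<close>

definition is_denominator :: "(real ^ 'm) set \<Rightarrow> real \<Rightarrow> bool" where
  "is_denominator P d \<longleftrightarrow>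
     d > 0 \<and> vertices ((\<lambda>x. d *\<^sub>R x) ` P) \<subseteq> int_points \<and>
     (\<forall>e>0. vertices ((\<lambda>x. e *\<^sub>R x) ` P) \<subseteq> int_points \<longrightarrow> d \<le> e)"

text \<open>\<open>upper_frac x\<close> is \<open>\<langle>x\<rangle>\<close>, with values in the interval from -1 (excluded) to 0 (included);
  \<open>{x}\<close> is the library function \<open>frac\<close>.\<close>

definition upper_frac :: "real \<Rightarrow> real" where
  "upper_frac x = x - of_int \<lceil>x\<rceil>"

text \<open>The \<open>j\<close>-th elementary symmetric polynomial evaluated at \<open>x 1, \<dots>, x n\<close>.\<close>

definition elem_sym :: "nat \<Rightarrow> nat \<Rightarrow> (nat \<Rightarrow> real) \<Rightarrow> real" where
  "elem_sym n j x = (\<Sum>A | A \<subseteq> {1..n} \<and> card A = j. \<Prod>i\<in>A. x i)"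

text \<open>In the following, the simplex is given by its vertices \<open>\<alpha> 0, \<dots>, \<alpha> n\<close> and its denominator \<open>d\<close>.\<close>

definition det_set :: "nat \<Rightarrow> (nat \<Rightarrow> real ^ 'm) \<Rightarrow> real \<Rightarrow> real \<Rightarrow> (real ^ 'm) set" where
  "det_set n \<alpha> d l =
     {p \<in> int_points. \<exists>u. (\<forall>j\<le>n. 0 \<le> u j \<and> u j < d) \<and> (\<Sum>j\<le>n. u j) = l \<and>
                          p = (\<Sum>j\<le>n. u j *\<^sub>R \<alpha> j)}"

definition det_set_bar :: "nat \<Rightarrow> (nat \<Rightarrow> real ^ 'm) \<Rightarrow> real \<Rightarrow> real \<Rightarrow> (real ^ 'm) set" where
  "det_set_bar n \<alpha> d l =
     {p \<in> int_points. \<exists>v. (\<forall>j\<le>n. 0 < v j \<and> v j \<le> d) \<and> (\<Sum>j\<le>n. v j) = l \<and>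
                          p = (\<Sum>j\<le>n. v j *\<^sub>R \<alpha> j)}"

definition coeff_closed :: "nat \<Rightarrow> (nat \<Rightarrow> real ^ 'm) \<Rightarrow> real \<Rightarrow> nat \<Rightarrow> real \<Rightarrow> real" where
  "coeff_closed n \<alpha> d k t =
     1 / (fact n * d ^ k) *
     (\<Sum>j=0..n. real (card (det_set n \<alpha> d (d * real j + d * frac (t / d)))) *
        elem_sym n (n - k) (\<lambda>i. real i - real j - frac (t / d)))"

definition coeff_open :: "nat \<Rightarrow> (nat \<Rightarrow> real ^ 'm) \<Rightarrow> real \<Rightarrow> nat \<Rightarrow> real \<Rightarrow> real" where
  "coeff_open n \<alpha> d k t =
     1 / (fact n * d ^ k) *
     (\<Sum>j=1..n+1. real (card (det_set_bar n \<alpha> d (d * real j + d * upper_frac (t / d)))) *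
        elem_sym n (n - k) (\<lambda>i. real i - real j - upper_frac (t / d)))"

definition L_closed :: "nat \<Rightarrow> (nat \<Rightarrow> real ^ 'm) \<Rightarrow> real \<Rightarrow> real \<Rightarrow> real" where
  "L_closed n \<alpha> d t = (\<Sum>k=0..n. coeff_closed n \<alpha> d k t * t ^ k)"

definition L_open :: "nat \<Rightarrow> (nat \<Rightarrow> real ^ 'm) \<Rightarrow> real \<Rightarrow> real \<Rightarrow> real" where
  "L_open n \<alpha> d t = (\<Sum>k=0..n. coeff_open n \<alpha> d k t * t ^ k)"

end

theory Submission
  imports Defs
begin

text \<open>
  A point of \<open>t \<sigma>\<close> is uniquely a combination \<open>\<Sum> \<lambda>\<^sub>j \<alpha>\<^sub>j\<close> with \<open>\<lambda>\<^sub>j \<ge> 0\<close> of sum \<open>t\<close>. Reducing every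
  \<open>\<lambda>\<^sub>j\<close> modulo \<open>d\<close> changes it by a lattice vector, so the lattice points of \<open>t \<sigma>\<close> correspond to a
  point of some determined set \<open>D(\<sigma>, dj + d{t/d})\<close> together with a composition of \<open>\<lfloor>t/d\<rfloor> - j\<close> into
  \<open>n + 1\<close> natural numbers. The number of these compositions is a binomial coefficient, which as a
  polynomial in \<open>t\<close> has the given elementary symmetric polynomials as coefficients; the terms with
  \<open>j > \<lfloor>t/d\<rfloor>\<close> vanish. The relative interior is treated in the same way with residues in \<open>(0, d]\<close>.
  Reciprocity follows from the bijection \<open>p \<mapsto> \<Sum> d \<alpha>\<^sub>j - p\<close> between \<open>D(\<sigma>, l)\<close> and
  \<open>D\<close>-bar\<open>(\<sigma>, (n + 1) d - l)\<close>.
\<close>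

section \<open>Elementary symmetric polynomials and binomial coefficients\<close>

lemma sum_elem_sym_eq_prod:
  "(\<Sum>k=0..n. elem_sym n (n - k) x * T ^ k) = (\<Prod>i=1..n. T + x i)"
proof -
  have "(\<Prod>i=1..n. T + x i) = (\<Prod>i=1..n. x i + T)"
    by (simp add: add.commute)
  also have "\<dots> = (\<Sum>A\<in>Pow {1..n}. (\<Prod>i\<in>A. x i) * T ^ card ({1..n} - A))"
    by (subst prod_add) simp_all
  also have "\<dots> = (\<Sum>A\<in>Pow {1..n}. (\<Prod>i\<in>A. x i) * T ^ (n - card A))"
    by (intro sum.cong refl) (simp add: card_Diff_subset finite_subset)
  also have "\<dots> = (\<Sum>j\<in>{0..n}. \<Sum>A\<in>{A \<in> Pow {1..n}. card A = j}. (\<Prod>i\<in>A. x i) * T ^ (n - card A))"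
    by (rule sum.group [symmetric]) (auto dest: card_mono [rotated])
  also have "\<dots> = (\<Sum>j=0..n. elem_sym n j x * T ^ (n - j))"
    by (simp add: elem_sym_def sum_distrib_right)
  also have "\<dots> = (\<Sum>k=0..n. elem_sym n (n - k) x * T ^ k)"
    by (rule sum.reindex_bij_witness [of _ "\<lambda>k. n - k" "\<lambda>k. n - k"]) auto
  finally show ?thesis ..
qed

text \<open>Exchanging the sums over \<open>k\<close> and \<open>j\<close> lets \<open>d ^ k\<close>
  merge with \<open>t ^ k\<close> into a power of \<open>t / d\<close>, so that for each
  \<open>j\<close> the coefficients reassemble into one product. \<open>J\<close>, \<open>c\<close>
  and \<open>x\<close> are arbitrary to cover both \<open>L_closed\<close> and
  \<open>L_open\<close>.\<close>

lemma quasipolynomial_eq_sum_prod: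
  fixes d :: real
  assumes "d > 0"
  shows "(\<Sum>k=0..n. 1 / (fact n * d ^ k) * (\<Sum>j\<in>J. c j * elem_sym n (n - k) (x j)) * t ^ k) =
         (\<Sum>j\<in>J. c j * ((\<Prod>i=1..n. t / d + x j i) / fact n))"
proof -
  have "(\<Sum>k=0..n. 1 / (fact n * d ^ k) * (\<Sum>j\<in>J. c j * elem_sym n (n - k) (x j)) * t ^ k) =
        (\<Sum>k=0..n. \<Sum>j\<in>J. c j * (elem_sym n (n - k) (x j) * (t / d) ^ k / fact n))"
    by (simp add: sum_distrib_left sum_distrib_right power_divide mult_ac)
  also have "\<dots> = (\<Sum>j\<in>J. c j * ((\<Sum>k=0..n. elem_sym n (n - k) (x j) * (t / d) ^ k) / fact n))"
    by (subst sum.swap) (simp add: sum_distrib_left sum_divide_distrib)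
  finally show ?thesis
    by (simp only: sum_elem_sym_eq_prod)
qed

lemma L_closed_eq:
  assumes "d > 0"
  shows "L_closed n \<alpha> d t =
    (\<Sum>j=0..n. real (card (det_set n \<alpha> d (d * real j + d * frac (t / d)))) *
       ((\<Prod>i=1..n. t / d + (real i - real j - frac (t / d))) / fact n))"
  unfolding L_closed_def coeff_closed_def by (rule quasipolynomial_eq_sum_prod [OF assms])

lemma L_open_eq:
  assumes "d > 0"
  shows "L_open n \<alpha> d t =
    (\<Sum>j=1..n+1. real (card (det_set_bar n \<alpha> d (d * real j + d * upper_frac (t / d)))) *
       ((\<Prod>i=1..n. t / d + (real i - real j - upper_frac (t / d))) / fact n))"
  unfolding L_open_def coeff_open_def by (rule quasipolynomial_eq_sum_prod [OF assms])

lemma prod_shifted_eq_binomial: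
  "(\<Prod>i=1..n. real m + real i) / fact n = real ((m + n) choose n)"
proof -
  have "(\<Prod>i=1..n. real m + real i) = pochhammer (real m + 1) n"
    unfolding pochhammer_prod
    by (rule prod.reindex_bij_witness [of _ Suc "\<lambda>i. i - 1"]) auto
  then show ?thesis
    by (simp add: binomial_gbinomial gbinomial_pochhammer')
qed

text \<open>For \<open>j > m\<close> the factor at \<open>i = j - m\<close> is zero, and the
  hypothesis places this index in \<open>{1..n}\<close>. In the quasi-polynomials \<open>m\<close>
  is \<open>t / d\<close> rounded down or up.\<close>

lemma prod_shifted_eq_binomial_or_zero:
  assumes "j \<le> m + n"
  shows "(\<Prod>i=1..n. real m + (real i - real j)) / fact n =
         (if j \<le> m then real ((m - j + n) choose n) else 0)"
proof (cases "j \<le> m")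
  case True
  then have "(\<Prod>i=1..n. real m + (real i - real j)) = (\<Prod>i=1..n. real (m - j) + real i)"
    by (intro prod.cong) (auto simp: of_nat_diff)
  with True show ?thesis
    using prod_shifted_eq_binomial [of "m - j" n] by simp
next
  case False
  with assms have "j - m \<in> {1..n}" "real m + (real (j - m) - real j) = 0"
    by (auto simp: of_nat_diff)
  then have "(\<Prod>i=1..n. real m + (real i - real j)) = 0"
    by (intro prod_zero) blast+
  with False show ?thesis by simp
qed

section \<open>Lattice points and their coefficients with respect to the vertices\<close>

lemma int_points_add: "x \<in> int_points \<Longrightarrow> y \<in> int_points \<Longrightarrow> x + y \<in> int_points"
  by (simp add: int_points_def)

lemma int_points_diff: "x \<in> int_points \<Longrightarrow> y \<in> int_points \<Longrightarrow> x - y \<in> int_points"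
  by (simp add: int_points_def)

lemma int_points_sum: "(\<And>i. i \<in> A \<Longrightarrow> f i \<in> int_points) \<Longrightarrow> (\<Sum>i\<in>A. f i) \<in> int_points"
  by (auto simp: int_points_def intro: Ints_sum)

lemma int_points_scaleR_of_nat: "x \<in> int_points \<Longrightarrow> real m *\<^sub>R x \<in> int_points"
  by (simp add: int_points_def)

lemma finite_bounded_int_points:
  fixes S :: "(real ^ 'm) set"
  assumes "bounded S"
  shows "finite (S \<inter> int_points)"
proof -
  obtain K where K: "\<And>x. x \<in> S \<Longrightarrow> norm x \<le> K"
    using assms by (auto simp: bounded_iff)
  define Z where "Z = real_of_int ` {\<lfloor>-K\<rfloor>..\<lceil>K\<rceil>}"
  have "S \<inter> int_points \<subseteq> vec_lambda ` (UNIV \<rightarrow>\<^sub>E Z)"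
  proof
    fix x assume x: "x \<in> S \<inter> int_points"
    have "x $ i \<in> Z" for i
    proof -
      obtain k where k: "x $ i = of_int k"
        using x by (auto simp: int_points_def elim: Ints_cases)
      have "\<bar>x $ i\<bar> \<le> K"
        using component_le_norm_cart [of x i] K [of x] x by auto
      with k have "k \<in> {\<lfloor>-K\<rfloor>..\<lceil>K\<rceil>}" by (auto; linarith)
      with k show ?thesis by (auto simp: Z_def)
    qed
    then have "vec_nth x \<in> UNIV \<rightarrow>\<^sub>E Z" by auto
    then show "x \<in> vec_lambda ` (UNIV \<rightarrow>\<^sub>E Z)"
      by (metis image_eqI vec_nth_inverse)
  qed
  moreover have "finite ((UNIV :: 'm set) \<rightarrow>\<^sub>E Z)"
    by (rule finite_PiE) (auto simp: Z_def)
  ultimately show ?thesis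
    using finite_subset by blast
qed

text \<open>The range \<open>B\<close> is a parameter since four occur: \<open>{0..<d}\<close> and
  \<open>{0<..d}\<close> give the determined sets, \<open>{0..}\<close> and \<open>{0<..}\<close>
  the lattice points of a dilated simplex and of its relative interior.\<close>

definition coef_points :: "nat \<Rightarrow> (nat \<Rightarrow> real ^ 'm) \<Rightarrow> real set \<Rightarrow> real \<Rightarrow> (real ^ 'm) set" where
  "coef_points n \<alpha> B l =
     {p \<in> int_points. \<exists>u. (\<forall>j\<le>n. u j \<in> B) \<and> (\<Sum>j\<le>n. u j) = l \<and> p = (\<Sum>j\<le>n. u j *\<^sub>R \<alpha> j)}"

lemma det_set_eq_coef_points: "det_set n \<alpha> d l = coef_points n \<alpha> {0..<d} l"
  by (simp add: det_set_def coef_points_def)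

lemma det_set_bar_eq_coef_points: "det_set_bar n \<alpha> d l = coef_points n \<alpha> {0<..d} l"
  by (simp add: det_set_bar_def coef_points_def)

lemma finite_coef_points:
  assumes "B \<subseteq> {0..d}"
  shows "finite (coef_points n \<alpha> B l)"
proof -
  let ?S = "{p. \<exists>u. (\<forall>j\<le>n. u j \<in> B) \<and> p = (\<Sum>j\<le>n. u j *\<^sub>R \<alpha> j)}"
  have "norm p \<le> (\<Sum>j\<le>n. d * norm (\<alpha> j))" if p: "p \<in> ?S" for p
  proof -
    obtain u where u: "\<forall>j\<le>n. u j \<in> B" "p = (\<Sum>j\<le>n. u j *\<^sub>R \<alpha> j)"
      using p by blast
    have "norm (u j *\<^sub>R \<alpha> j) \<le> d * norm (\<alpha> j)" if "j \<le> n" for j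
      using u(1) assms that by (auto intro!: mult_right_mono)
    then show ?thesis
      unfolding u(2) by (intro sum_norm_le) auto
  qed
  then have "bounded ?S" by (auto simp: bounded_iff)
  then have "finite (?S \<inter> int_points)" by (rule finite_bounded_int_points)
  then show ?thesis by (rule rev_finite_subset) (auto simp: coef_points_def)
qed

text \<open>Division with remainder by \<open>d\<close>, applied to every coefficient:
  \<open>B\<close> is the set of remainders, \<open>C\<close> the range of the coefficients, and
  \<open>uniq\<close> makes the quotients unique. By \<open>indep\<close>, a point and its
  coefficient sum determine the coefficients. \<open>J\<close> contains every level \<open>s\<close>
  for which \<open>n + 1\<close> remainders can have the sum \<open>d * s + d * \<tau>\<close>.
  Remainders of level \<open>j\<close> leave quotients of sum \<open>F - j\<close>, which accounts
  for the binomial factor.\<close>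

lemma card_coef_points:
  fixes \<alpha> :: "nat \<Rightarrow> real ^ 'm"
  assumes indep: "\<And>w. (\<Sum>j\<le>n. w j) = 0 \<Longrightarrow> (\<Sum>j\<le>n. w j *\<^sub>R \<alpha> j) = 0 \<Longrightarrow> \<forall>j\<le>n. w j = 0"
    and lattice: "\<And>j. j \<le> n \<Longrightarrow> d *\<^sub>R \<alpha> j \<in> int_points"
    and B: "B \<subseteq> {0..d}"
    and C: "\<And>x. x \<in> C \<longleftrightarrow> (\<exists>m::nat. \<exists>u\<in>B. x = d * real m + u)"
    and uniq: "\<And>u v m k. u \<in> B \<Longrightarrow> v \<in> B \<Longrightarrow> d * real m + u = d * real k + v \<Longrightarrow> m = k"
    and J: "\<And>u s. \<forall>j\<le>n. u j \<in> B \<Longrightarrow> (\<Sum>j\<le>n. u j) = d * of_int s + d * \<tau> \<Longrightarrow> s \<in> int ` J"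
    and d: "d > 0" and "finite J"
  shows "card (coef_points n \<alpha> C (d * real F + d * \<tau>)) =
    (\<Sum>j\<in>{j\<in>J. j \<le> F}. card (coef_points n \<alpha> B (d * real j + d * \<tau>)) * ((F - j + n) choose n))"
proof -
  define X :: "nat \<Rightarrow> nat list set" where "X r = {xs. length xs = n + 1 \<and> sum_list xs = r}" for r
  define Y where "Y j = coef_points n \<alpha> B (d * real j + d * \<tau>) \<times> X (F - j)" for j
  define I where "I = {j\<in>J. j \<le> F}"
  \<comment> \<open>\<open>f\<close> adds multiples of \<open>d\<close> back to the coefficients of
    a point \<open>p\<close> of remainders. It ignores the level \<open>j\<close>, so injectivity
    has to recover \<open>j\<close> from the sum of the remainders.\<close>
  define f where "f = (\<lambda>(j::nat, p, xs). p + (\<Sum>i\<le>n. real (xs ! i) *\<^sub>R d *\<^sub>R \<alpha> i))"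
  have sum_X: "(\<Sum>i\<le>n. xs ! i) = r" if "xs \<in> X r" for xs r
  proof -
    have "sum_list xs = (\<Sum>i\<in>{0..<length xs}. xs ! i)" by (rule sum_list_sum_nth)
    also have "{0..<length xs} = {..n}" using that by (auto simp: X_def)
    finally show ?thesis using that by (simp add: X_def)
  qed
  \<comment> \<open>Stars and bars gives \<open>(r + n) choose r\<close>; symmetry makes the lower
    index \<open>n\<close>.\<close>
  have card_X: "card (X r) = (r + n) choose n" for r
    using card_length_sum_list [of "n + 1" r] binomial_symmetric [of n "r + n"]
    by (simp add: X_def)
  have combine: "(\<Sum>i\<le>n. u i *\<^sub>R \<alpha> i) + (\<Sum>i\<le>n. real (x i) *\<^sub>R d *\<^sub>R \<alpha> i) =
                 (\<Sum>i\<le>n. (d * real (x i) + u i) *\<^sub>R \<alpha> i)" for u and x :: "nat \<Rightarrow> nat"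
    by (simp add: sum.distrib [symmetric] algebra_simps)
  have inj: "inj_on f (Sigma I Y)"
  proof (rule inj_onI)
    fix a b assume ab: "a \<in> Sigma I Y" "b \<in> Sigma I Y" "f a = f b"
    obtain j p xs where a: "a = (j, p, xs)" by (cases a)
    obtain k q ys where b: "b = (k, q, ys)" by (cases b)
    have jk: "j \<le> F" "k \<le> F" and xs: "xs \<in> X (F - j)" and ys: "ys \<in> X (F - k)"
      using ab a b by (auto simp: I_def Y_def)
    obtain u where u: "\<forall>i\<le>n. u i \<in> B" "(\<Sum>i\<le>n. u i) = d * real j + d * \<tau>" "p = (\<Sum>i\<le>n. u i *\<^sub>R \<alpha> i)"
      using ab a by (auto simp: Y_def coef_points_def)
    obtain v where v: "\<forall>i\<le>n. v i \<in> B" "(\<Sum>i\<le>n. v i) = d * real k + d * \<tau>" "q = (\<Sum>i\<le>n. v i *\<^sub>R \<alpha> i)"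
      using ab b by (auto simp: Y_def coef_points_def)
    \<comment> \<open>The difference of two coefficient families of the common image. Both sum to
      \<open>d * F + d * \<tau>\<close>, whatever the level, so \<open>indep\<close> forces
      \<open>w\<close> to vanish.\<close>
    define w where "w i = (d * real (xs ! i) + u i) - (d * real (ys ! i) + v i)" for i
    have total: "(\<Sum>i\<le>n. d * real (zs ! i) + y i) = d * real F + d * \<tau>"
      if "zs \<in> X (F - l)" "l \<le> F" "(\<Sum>i\<le>n. y i) = d * real l + d * \<tau>" for zs y l
    proof -
      have "(\<Sum>i\<le>n. d * real (zs ! i) + y i) = d * real (\<Sum>i\<le>n. zs ! i) + (\<Sum>i\<le>n. y i)"
        by (simp add: sum.distrib sum_distrib_left)
      then show ?thesis
        using that by (simp add: sum_X of_nat_diff algebra_simps)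
    qed
    have "(\<Sum>i\<le>n. w i) = 0"
      unfolding w_def sum_subtractf using total [OF xs jk(1) u(2)] total [OF ys jk(2) v(2)] by simp
    moreover have "(\<Sum>i\<le>n. w i *\<^sub>R \<alpha> i) = 0"
      using ab(3) unfolding a b f_def w_def scaleR_left_diff_distrib sum_subtractf
      by (simp only: u(3) v(3) combine prod.case) simp
    ultimately have w0: "\<forall>i\<le>n. w i = 0" by (rule indep)
    have nth: "xs ! i = ys ! i" if "i \<le> n" for i
      using uniq [of "u i" "v i" "xs ! i" "ys ! i"] w0 u(1) v(1) that by (simp add: w_def)
    then have "xs = ys"
      using xs ys by (intro nth_equalityI) (auto simp: X_def)
    moreover have "\<forall>i\<le>n. u i = v i" using w0 nth by (simp add: w_def)
    then have "p = q" by (simp add: u(3) v(3))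
    moreover have "j = k"
      using \<open>\<forall>i\<le>n. u i = v i\<close> u(2) v(2) d by simp
    ultimately show "a = b" by (simp add: a b)
  qed
  have img: "f ` Sigma I Y = coef_points n \<alpha> C (d * real F + d * \<tau>)"
  proof (intro equalityI subsetI)
    fix y assume "y \<in> f ` Sigma I Y"
    then obtain j p xs where y: "y = p + (\<Sum>i\<le>n. real (xs ! i) *\<^sub>R d *\<^sub>R \<alpha> i)"
      and j: "j \<le> F" and xs: "xs \<in> X (F - j)" and p: "p \<in> coef_points n \<alpha> B (d * real j + d * \<tau>)"
      by (auto simp: f_def I_def Y_def)
    obtain u where u: "\<forall>i\<le>n. u i \<in> B" "(\<Sum>i\<le>n. u i) = d * real j + d * \<tau>" "p = (\<Sum>i\<le>n. u i *\<^sub>R \<alpha> i)"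
      using p by (auto simp: coef_points_def)
    have "y \<in> int_points"
      unfolding y using p lattice
      by (intro int_points_add int_points_sum int_points_scaleR_of_nat) (auto simp: coef_points_def)
    moreover have "\<forall>i\<le>n. d * real (xs ! i) + u i \<in> C" using u(1) C by blast
    moreover have "(\<Sum>i\<le>n. d * real (xs ! i) + u i) = d * real (\<Sum>i\<le>n. xs ! i) + (\<Sum>i\<le>n. u i)"
      by (simp add: sum.distrib sum_distrib_left)
    then have "(\<Sum>i\<le>n. d * real (xs ! i) + u i) = d * real F + d * \<tau>"
      using sum_X [OF xs] j u(2) by (simp add: of_nat_diff algebra_simps)
    moreover have "y = (\<Sum>i\<le>n. (d * real (xs ! i) + u i) *\<^sub>R \<alpha> i)"
      by (simp only: y u(3) combine)
    ultimately show "y \<in> coef_points n \<alpha> C (d * real F + d * \<tau>)"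
      unfolding coef_points_def by (intro CollectI conjI exI [of _ "\<lambda>i. d * real (xs ! i) + u i"])
  next
    fix y assume "y \<in> coef_points n \<alpha> C (d * real F + d * \<tau>)"
    then obtain c where y: "y \<in> int_points" and c: "\<forall>i\<le>n. c i \<in> C"
      and sc: "(\<Sum>i\<le>n. c i) = d * real F + d * \<tau>" and yc: "y = (\<Sum>i\<le>n. c i *\<^sub>R \<alpha> i)"
      by (auto simp: coef_points_def)
    have "\<forall>i. \<exists>m u. i \<le> n \<longrightarrow> u \<in> B \<and> c i = d * real m + u"
      using c C by blast
    then obtain m u where mu: "\<And>i. i \<le> n \<Longrightarrow> u i \<in> B" "\<And>i. i \<le> n \<Longrightarrow> c i = d * real (m i) + u i"
      by metis
    define xs where "xs = map m [0..<n+1]"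
    have len: "length xs = n + 1" and nth: "\<And>i. i \<le> n \<Longrightarrow> xs ! i = m i"
      by (auto simp: xs_def simp del: upt_Suc)
    define M where "M = sum_list xs"
    have "xs \<in> X M" by (simp add: X_def len M_def)
    then have M: "(\<Sum>i\<le>n. m i) = M" using sum_X [of xs M] nth by simp
    have "d * real F + d * \<tau> = (\<Sum>i\<le>n. d * real (m i) + u i)"
      unfolding sc [symmetric] using mu(2) by (intro sum.cong) auto
    also have "\<dots> = d * real M + (\<Sum>i\<le>n. u i)"
      by (simp add: M [symmetric] sum.distrib sum_distrib_left)
    \<comment> \<open>The level \<open>F - M\<close> is taken as an integer because
      \<open>M \<le> F\<close> is not yet known; it follows once \<open>J\<close> identifies the
      level with a natural number.\<close>
    finally have su: "(\<Sum>i\<le>n. u i) = d * of_int (int F - int M) + d * \<tau>"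
      by (simp add: algebra_simps)
    then obtain j where j: "j \<in> J" "int F - int M = int j"
      using J [of u "int F - int M"] mu(1) by auto
    then have "j \<le> F" "M = F - j" by auto
    define p where "p = (\<Sum>i\<le>n. u i *\<^sub>R \<alpha> i)"
    have yp: "y = p + (\<Sum>i\<le>n. real (m i) *\<^sub>R d *\<^sub>R \<alpha> i)"
      unfolding p_def combine yc using mu(2) by (intro sum.cong) auto
    then have "p = y - (\<Sum>i\<le>n. real (m i) *\<^sub>R d *\<^sub>R \<alpha> i)" by simp
    also have "\<dots> \<in> int_points"
      using y lattice by (intro int_points_diff int_points_sum int_points_scaleR_of_nat) auto
    finally have "p \<in> coef_points n \<alpha> B (d * real j + d * \<tau>)"
      using mu(1) su j by (auto simp: coef_points_def p_def)
    then have "(j, p, xs) \<in> Sigma I Y"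
      using j \<open>j \<le> F\<close> \<open>M = F - j\<close> \<open>xs \<in> X M\<close> by (simp add: I_def Y_def)
    moreover have "y = f (j, p, xs)"
      using yp nth by (simp add: f_def)
    ultimately show "y \<in> f ` Sigma I Y" by (rule rev_image_eqI)
  qed
  \<comment> \<open>Finiteness is read off from the cardinality: \<open>(r + n) choose n\<close> is
    positive, while an infinite set has cardinality 0.\<close>
  have "finite (X r)" for r
    using card_X [of r] by (intro card_ge_0_finite) simp
  then have "finite (Y j)" for j
    by (simp add: Y_def finite_coef_points [OF B])
  moreover have "finite I" using \<open>finite J\<close> by (simp add: I_def)
  ultimately have "card (Sigma I Y) = (\<Sum>j\<in>I. card (Y j))" by simp
  then show ?thesis
    using card_image [OF inj] unfolding img
    by (simp add: Y_def I_def card_cartesian_product card_X)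
qed

section \<open>Reciprocity between the two quasi-polynomials\<close>

lemma card_det_set_bar_complement:
  assumes "\<And>j. j \<le> n \<Longrightarrow> d *\<^sub>R \<alpha> j \<in> int_points"
  shows "card (det_set_bar n \<alpha> d (real (n + 1) * d - l)) = card (det_set n \<alpha> d l)"
proof -
  let ?s = "\<Sum>j\<le>n. d *\<^sub>R \<alpha> j"
  have s: "?s \<in> int_points" using assms by (intro int_points_sum) auto
  \<comment> \<open>The coefficients \<open>d - u j\<close> exchange the ranges
    \<open>[0, d)\<close> and \<open>(0, d]\<close>, and the sum \<open>l\<close> becomes
    \<open>(n + 1) d - l\<close>.\<close>
  have to_bar: "?s - p \<in> det_set_bar n \<alpha> d (real (n + 1) * d - l)" if p: "p \<in> det_set n \<alpha> d l" for p
  proof -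
    obtain u where "p \<in> int_points" "\<forall>j\<le>n. 0 \<le> u j \<and> u j < d" "(\<Sum>j\<le>n. u j) = l"
      "p = (\<Sum>j\<le>n. u j *\<^sub>R \<alpha> j)"
      using p unfolding det_set_def by blast
    then show ?thesis
      unfolding det_set_bar_def
      by (intro CollectI conjI exI [of _ "\<lambda>j. d - u j"] int_points_diff s)
        (auto simp: sum_subtractf algebra_simps)
  qed
  have from_bar: "?s - p \<in> det_set n \<alpha> d l" if p: "p \<in> det_set_bar n \<alpha> d (real (n + 1) * d - l)" for p
  proof -
    obtain u where "p \<in> int_points" "\<forall>j\<le>n. 0 < u j \<and> u j \<le> d" "(\<Sum>j\<le>n. u j) = real (n + 1) * d - l"
      "p = (\<Sum>j\<le>n. u j *\<^sub>R \<alpha> j)"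
      using p unfolding det_set_bar_def by blast
    then show ?thesis
      unfolding det_set_def
      by (intro CollectI conjI exI [of _ "\<lambda>j. d - u j"] int_points_diff s)
        (auto simp: sum_subtractf algebra_simps)
  qed
  have "bij_betw (\<lambda>p. ?s - p) (det_set_bar n \<alpha> d (real (n + 1) * d - l)) (det_set n \<alpha> d l)"
    by (rule bij_betw_byWitness [where f' = "\<lambda>p. ?s - p"]) (use to_bar from_bar in auto)
  then show ?thesis by (rule bij_betw_same_card)
qed

lemma upper_frac_minus: "upper_frac (- x) = - frac x"
  by (simp add: upper_frac_def frac_def ceiling_minus)

text \<open>The two sums are matched under \<open>j \<mapsto> n + 1 - j\<close>, where the
  determined sets are complementary and the products agree up to sign. The comparison is made on the
  formulas themselves, hence holds for all real \<open>t\<close>.\<close>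

lemma L_open_minus:
  assumes lattice: "\<And>j. j \<le> n \<Longrightarrow> d *\<^sub>R \<alpha> j \<in> int_points" and d: "d > 0"
  shows "L_open n \<alpha> d (- t) = (-1) ^ n * L_closed n \<alpha> d t"
proof -
  define \<tau> where "\<tau> = frac (t / d)"
  have uf: "upper_frac (- t / d) = - \<tau>"
    using upper_frac_minus [of "t / d"] by (simp add: \<tau>_def)
  have prods: "(\<Prod>i=1..n. - t / d + (real i - real (n + 1 - j) + \<tau>)) =
      (-1) ^ n * (\<Prod>i=1..n. t / d + (real i - real j - \<tau>))" if "j \<le> n" for j
  proof -
    \<comment> \<open>Reversing the index \<open>i\<close> to \<open>n + 1 - i\<close> turns each
      factor into the negative of its counterpart.\<close>
    have "(\<Prod>i=1..n. - t / d + (real i - real (n + 1 - j) + \<tau>)) =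
          (\<Prod>i=1..n. - 1 * (t / d + (real i - real j - \<tau>)))"
      using that
      by (intro prod.reindex_bij_witness [of _ "\<lambda>i. n + 1 - i" "\<lambda>i. n + 1 - i"])
        (auto simp: of_nat_diff algebra_simps)
    then show ?thesis by (simp only: prod.distrib) simp
  qed
  have "L_open n \<alpha> d (- t) =
    (\<Sum>j=1..n+1. real (card (det_set_bar n \<alpha> d (d * real j - d * \<tau>))) *
       ((\<Prod>i=1..n. - t / d + (real i - real j + \<tau>)) / fact n))"
    unfolding L_open_eq [OF d] uf by simp
  also have "\<dots> = (\<Sum>j=0..n. real (card (det_set_bar n \<alpha> d (d * real (n + 1 - j) - d * \<tau>))) *
       ((\<Prod>i=1..n. - t / d + (real i - real (n + 1 - j) + \<tau>)) / fact n))"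
    by (rule sum.reindex_bij_witness [of _ "\<lambda>j. n + 1 - j" "\<lambda>j. n + 1 - j"]) auto
  also have "\<dots> = (\<Sum>j=0..n. real (card (det_set n \<alpha> d (d * real j + d * \<tau>))) *
       (((-1) ^ n * (\<Prod>i=1..n. t / d + (real i - real j - \<tau>))) / fact n))"
  proof (rule sum.cong [OF refl])
    fix j assume "j \<in> {0..n}"
    then have j: "j \<le> n" by simp
    then have "d * real (n + 1 - j) - d * \<tau> = real (n + 1) * d - (d * real j + d * \<tau>)"
      by (simp add: of_nat_diff algebra_simps)
    with card_det_set_bar_complement [where n = n and d = d and \<alpha> = \<alpha> and l = "d * real j + d * \<tau>", OF lattice]
    show "real (card (det_set_bar n \<alpha> d (d * real (n + 1 - j) - d * \<tau>))) *
       ((\<Prod>i=1..n. - t / d + (real i - real (n + 1 - j) + \<tau>)) / fact n) =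
      real (card (det_set n \<alpha> d (d * real j + d * \<tau>))) *
       (((-1) ^ n * (\<Prod>i=1..n. t / d + (real i - real j - \<tau>))) / fact n)"
      unfolding prods [OF j] by (simp only:)
  qed
  also have "\<dots> = (-1) ^ n * L_closed n \<alpha> d t"
    unfolding L_closed_eq [OF d] \<tau>_def [symmetric] by (simp add: sum_distrib_left mult_ac)
  finally show ?thesis .
qed

section \<open>Counting the lattice points of real dilates\<close>

lemma residue_mod_unique:
  fixes d :: real
  assumes "d > 0" "\<bar>u - v\<bar> < d" "d * real m + u = d * real k + v"
  shows "m = k"
proof -
  have "\<bar>d * (real m - real k)\<bar> < d * 1"
    using assms by (simp add: algebra_simps)
  then have "\<bar>real m - real k\<bar> < 1"
    using assms(1) by (simp add: abs_mult)
  then show ?thesis by linarith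
qed

text \<open>Division by \<open>d\<close> with remainders in \<open>[0, d)\<close>: \<open>F\<close>
  and \<open>\<tau>\<close> are the integer and fractional parts of \<open>t / d\<close>, and the
  levels are \<open>0, ..., n\<close>.\<close>

lemma L_closed_eq_card:
  fixes \<alpha> :: "nat \<Rightarrow> real ^ 'm"
  assumes indep: "\<And>w. (\<Sum>j\<le>n. w j) = 0 \<Longrightarrow> (\<Sum>j\<le>n. w j *\<^sub>R \<alpha> j) = 0 \<Longrightarrow> \<forall>j\<le>n. w j = 0"
    and lattice: "\<And>j. j \<le> n \<Longrightarrow> d *\<^sub>R \<alpha> j \<in> int_points"
    and d: "d > 0" and t: "t \<ge> 0"
  shows "L_closed n \<alpha> d t = real (card (coef_points n \<alpha> {0..} t))"
proof -
  define \<tau> where "\<tau> = frac (t / d)"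
  define F where "F = nat \<lfloor>t / d\<rfloor>"
  have F: "t / d = real F + \<tau>"
    using t d by (simp add: F_def \<tau>_def frac_def)
  then have tF: "t = d * real F + d * \<tau>"
    using d by (simp add: field_simps)
  have \<tau>: "0 \<le> \<tau>" "\<tau> < 1" by (simp_all add: \<tau>_def frac_lt_1)
  have "card (coef_points n \<alpha> {0..} t) =
    (\<Sum>j\<in>{j\<in>{0..n}. j \<le> F}. card (coef_points n \<alpha> {0..<d} (d * real j + d * \<tau>)) * ((F - j + n) choose n))"
    unfolding tF
  proof (rule card_coef_points [OF indep lattice])
    fix x
    have "\<exists>m::nat. \<exists>u\<in>{0..<d}. x = d * real m + u" if "x \<ge> 0"
    proof (intro exI bexI)
      have x: "real (nat \<lfloor>x / d\<rfloor>) = of_int \<lfloor>x / d\<rfloor>" using that d by simp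
      show "x = d * real (nat \<lfloor>x / d\<rfloor>) + d * frac (x / d)"
        unfolding x frac_def using d by (simp add: field_simps)
      show "d * frac (x / d) \<in> {0..<d}" using d by (simp add: frac_lt_1)
    qed
    then show "x \<in> {0..} \<longleftrightarrow> (\<exists>m::nat. \<exists>u\<in>{0..<d}. x = d * real m + u)"
      using d by auto
  next
    fix u :: "nat \<Rightarrow> real" and s
    assume u: "\<forall>j\<le>n. u j \<in> {0..<d}" and s: "(\<Sum>j\<le>n. u j) = d * of_int s + d * \<tau>"
    have "0 \<le> (\<Sum>j\<le>n. u j)" using u by (intro sum_nonneg) auto
    moreover have "(\<Sum>j\<le>n. u j) < (\<Sum>j\<le>n. d)" using u by (intro sum_strict_mono) auto
    ultimately have "d * 0 \<le> d * (of_int s + \<tau>)" "d * (of_int s + \<tau>) < d * (real n + 1)"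
      using s by (simp_all add: algebra_simps)
    then have "0 \<le> of_int s + \<tau>" "of_int s + \<tau> < real n + 1"
      using d by (simp_all only: mult_le_cancel_left_pos mult_less_cancel_left_pos)
    \<comment> \<open>With \<open>0 \<le> \<tau> < 1\<close>, the lower bound excludes level -1 and
      the strict upper bound excludes level \<open>n + 1\<close>.\<close>
    then have "0 \<le> s" "s \<le> int n" using \<tau> by linarith+
    then show "s \<in> int ` {0..n}" by (intro image_eqI [of _ _ "nat s"]) auto
  next
    fix u v m k assume "u \<in> {0..<d}" "v \<in> {0..<d}" "d * real m + u = d * real k + v"
    then show "m = k" by (intro residue_mod_unique [OF d, of u v]) auto
  qed (use d in auto)
  then have "real (card (coef_points n \<alpha> {0..} t)) =
      (\<Sum>j\<in>{j\<in>{0..n}. j \<le> F}. real (card (det_set n \<alpha> d (d * real j + d * \<tau>))) *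
      real ((F - j + n) choose n))"
    by (simp add: det_set_eq_coef_points)
  also have "\<dots> = (\<Sum>j=0..n. real (card (det_set n \<alpha> d (d * real j + d * \<tau>))) *
      (if j \<le> F then real ((F - j + n) choose n) else 0))"
    by (rule sum.mono_neutral_cong_left) auto
  also have "\<dots> = L_closed n \<alpha> d t"
    unfolding L_closed_eq [OF d] \<tau>_def [symmetric] unfolding F
  proof (rule sum.cong [OF refl])
    fix j assume "j \<in> {0..n}"
    then have "j \<le> F + n" by simp
    have "(\<Prod>i=1..n. real F + \<tau> + (real i - real j - \<tau>)) = (\<Prod>i=1..n. real F + (real i - real j))"
      by simp
    then show "real (card (det_set n \<alpha> d (d * real j + d * \<tau>))) *
        (if j \<le> F then real ((F - j + n) choose n) else 0) =
      real (card (det_set n \<alpha> d (d * real j + d * \<tau>))) *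
        ((\<Prod>i=1..n. real F + \<tau> + (real i - real j - \<tau>)) / fact n)"
      by (simp only: prod_shifted_eq_binomial_or_zero [OF \<open>j \<le> F + n\<close>])
  qed
  finally show ?thesis ..
qed

text \<open>Remainders now lie in \<open>(0, d]\<close>, so \<open>F\<close> is the ceiling of
  \<open>t / d\<close> and \<open>\<tau>\<close> lies in \<open>(-1, 0]\<close>; the levels shift to
  \<open>1, ..., n + 1\<close>.\<close>

lemma L_open_eq_card:
  fixes \<alpha> :: "nat \<Rightarrow> real ^ 'm"
  assumes indep: "\<And>w. (\<Sum>j\<le>n. w j) = 0 \<Longrightarrow> (\<Sum>j\<le>n. w j *\<^sub>R \<alpha> j) = 0 \<Longrightarrow> \<forall>j\<le>n. w j = 0"
    and lattice: "\<And>j. j \<le> n \<Longrightarrow> d *\<^sub>R \<alpha> j \<in> int_points"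
    and d: "d > 0" and t: "t > 0"
  shows "L_open n \<alpha> d t = real (card (coef_points n \<alpha> {0<..} t))"
proof -
  define \<tau> where "\<tau> = upper_frac (t / d)"
  define F where "F = nat \<lceil>t / d\<rceil>"
  have "t / d > 0" using t d by simp
  then have F: "t / d = real F + \<tau>" and "F \<ge> 1"
    by (simp add: F_def \<tau>_def upper_frac_def) (use \<open>t / d > 0\<close> F_def in linarith)
  then have tF: "t = d * real F + d * \<tau>"
    using d by (simp add: field_simps)
  have \<tau>: "-1 < \<tau>" "\<tau> \<le> 0" unfolding \<tau>_def upper_frac_def by linarith+
  have "card (coef_points n \<alpha> {0<..} t) =
    (\<Sum>j\<in>{j\<in>{1..n+1}. j \<le> F}. card (coef_points n \<alpha> {0<..d} (d * real j + d * \<tau>)) * ((F - j + n) choose n))"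
    unfolding tF
  proof (rule card_coef_points [OF indep lattice])
    fix x
    have "\<exists>m::nat. \<exists>u\<in>{0<..d}. x = d * real m + u" if "x > 0"
    proof (intro exI bexI)
      have "x / d > 0" using that d by simp
      then have "\<lceil>x / d\<rceil> \<ge> 1" by linarith
      \<comment> \<open>A multiple of \<open>d\<close> has remainder \<open>d\<close> rather than 0,
        hence the quotient is the ceiling minus 1.\<close>
      then have x: "real (nat (\<lceil>x / d\<rceil> - 1)) = of_int \<lceil>x / d\<rceil> - 1" by simp
      show "x = d * real (nat (\<lceil>x / d\<rceil> - 1)) + d * (upper_frac (x / d) + 1)"
        unfolding x upper_frac_def using d by (simp add: field_simps)
      have "0 < upper_frac (x / d) + 1" "upper_frac (x / d) + 1 \<le> 1"
        unfolding upper_frac_def by linarith+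
      then show "d * (upper_frac (x / d) + 1) \<in> {0<..d}" using d by simp
    qed
    then show "x \<in> {0<..} \<longleftrightarrow> (\<exists>m::nat. \<exists>u\<in>{0<..d}. x = d * real m + u)"
      using d by (auto intro: add_nonneg_pos)
  next
    fix u :: "nat \<Rightarrow> real" and s
    assume u: "\<forall>j\<le>n. u j \<in> {0<..d}" and s: "(\<Sum>j\<le>n. u j) = d * of_int s + d * \<tau>"
    have "0 < (\<Sum>j\<le>n. u j)" using u by (intro sum_pos) auto
    moreover have "(\<Sum>j\<le>n. u j) \<le> (\<Sum>j\<le>n. d)" using u by (intro sum_mono) auto
    ultimately have "d * 0 < d * (of_int s + \<tau>)" "d * (of_int s + \<tau>) \<le> d * (real n + 1)"
      using s by (simp_all add: algebra_simps)
    then have "0 < of_int s + \<tau>" "of_int s + \<tau> \<le> real n + 1"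
      using d by (simp_all only: mult_le_cancel_left_pos mult_less_cancel_left_pos)
    then have "1 \<le> s" "s \<le> int n + 1" using \<tau> by linarith+
    then show "s \<in> int ` {1..n+1}" by (intro image_eqI [of _ _ "nat s"]) auto
  next
    fix u v m k assume "u \<in> {0<..d}" "v \<in> {0<..d}" "d * real m + u = d * real k + v"
    then show "m = k" by (intro residue_mod_unique [OF d, of u v]) auto
  qed (use d in auto)
  then have "real (card (coef_points n \<alpha> {0<..} t)) =
      (\<Sum>j\<in>{j\<in>{1..n+1}. j \<le> F}. real (card (det_set_bar n \<alpha> d (d * real j + d * \<tau>))) *
      real ((F - j + n) choose n))"
    by (simp add: det_set_bar_eq_coef_points)
  also have "\<dots> = (\<Sum>j=1..n+1. real (card (det_set_bar n \<alpha> d (d * real j + d * \<tau>))) *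
      (if j \<le> F then real ((F - j + n) choose n) else 0))"
    by (rule sum.mono_neutral_cong_left) auto
  also have "\<dots> = L_open n \<alpha> d t"
    unfolding L_open_eq [OF d] \<tau>_def [symmetric] unfolding F
  proof (rule sum.cong [OF refl])
    fix j assume "j \<in> {1..n+1}"
    \<comment> \<open>The level \<open>n + 1\<close> meets this bound because
      \<open>F \<ge> 1\<close>, which comes from \<open>t > 0\<close>.\<close>
    then have "j \<le> F + n" using \<open>F \<ge> 1\<close> by simp
    have "(\<Prod>i=1..n. real F + \<tau> + (real i - real j - \<tau>)) = (\<Prod>i=1..n. real F + (real i - real j))"
      by simp
    then show "real (card (det_set_bar n \<alpha> d (d * real j + d * \<tau>))) *
        (if j \<le> F then real ((F - j + n) choose n) else 0) =
      real (card (det_set_bar n \<alpha> d (d * real j + d * \<tau>))) *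
        ((\<Prod>i=1..n. real F + \<tau> + (real i - real j - \<tau>)) / fact n)"
      by (simp only: prod_shifted_eq_binomial_or_zero [OF \<open>j \<le> F + n\<close>])
  qed
  finally show ?thesis ..
qed

section \<open>Dilated simplices in barycentric coordinates\<close>

lemma vertices_scaleR:
  fixes P :: "'a::euclidean_space set"
  assumes "c \<noteq> 0" "v \<in> vertices P"
  shows "c *\<^sub>R v \<in> vertices ((\<lambda>x. c *\<^sub>R x) ` P)"
proof -
  \<comment> \<open>Extreme points are the singleton faces, and injective linear maps preserve
    faces.\<close>
  have "((\<lambda>x. c *\<^sub>R x) ` {v}) face_of ((\<lambda>x. c *\<^sub>R x) ` P)"
    using assms face_of_linear_image [of "\<lambda>x. c *\<^sub>R x" "{v}" P]
    by (simp add: vertices_def face_of_singleton inj_on_def)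
  then show ?thesis
    by (simp add: vertices_def face_of_singleton)
qed

text \<open>Passes from weights on the vertex set, as in the descriptions of convex hulls and their
  relative interiors, to weights indexed by \<open>j\<close>. The predicate \<open>P\<close> serves
  for both nonnegative and positive weights.\<close>

lemma ex_coef_reindex:
  assumes "inj_on \<alpha> {..n}"
  shows "(\<exists>u. (\<forall>x\<in>\<alpha> ` {..n}. P (u x)) \<and> sum u (\<alpha> ` {..n}) = c \<and> (\<Sum>x\<in>\<alpha> ` {..n}. u x *\<^sub>R x) = y) \<longleftrightarrow>
         (\<exists>u. (\<forall>j\<le>n. P (u j)) \<and> (\<Sum>j\<le>n. u j) = c \<and> (\<Sum>j\<le>n. u j *\<^sub>R \<alpha> j) = y)"
    (is "?L \<longleftrightarrow> ?R")
proof
  assume ?L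
  then obtain u where "\<forall>x\<in>\<alpha> ` {..n}. P (u x)" "sum u (\<alpha> ` {..n}) = c"
    "(\<Sum>x\<in>\<alpha> ` {..n}. u x *\<^sub>R x) = y" by blast
  then show ?R
    by (intro exI [of _ "u \<circ> \<alpha>"]) (simp add: sum.reindex [OF assms])
next
  assume ?R
  then obtain u where "\<forall>j\<le>n. P (u j)" "(\<Sum>j\<le>n. u j) = c" "(\<Sum>j\<le>n. u j *\<^sub>R \<alpha> j) = y" by blast
  then show ?L
    by (intro exI [of _ "u \<circ> inv_into {..n} \<alpha>"])
      (simp add: sum.reindex [OF assms] inv_into_f_f [OF assms])
qed

text \<open>Multiplying or dividing all weights by \<open>t\<close> moves their sum between 1 and
  \<open>t\<close>; \<open>cone\<close> keeps them in \<open>C\<close> since \<open>t\<close> is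
  positive.\<close>

lemma scaled_eq_coef_points:
  fixes \<alpha> :: "nat \<Rightarrow> real ^ 'm"
  assumes S: "S = {y. \<exists>u. (\<forall>j\<le>n. u j \<in> C) \<and> (\<Sum>j\<le>n. u j) = 1 \<and> (\<Sum>j\<le>n. u j *\<^sub>R \<alpha> j) = y}"
    and cone: "\<And>c x. c > 0 \<Longrightarrow> x \<in> C \<Longrightarrow> c * x \<in> C" and t: "t > 0"
  shows "(\<lambda>x. t *\<^sub>R x) ` S \<inter> int_points = coef_points n \<alpha> C t"
proof (intro equalityI subsetI)
  fix p assume "p \<in> (\<lambda>x. t *\<^sub>R x) ` S \<inter> int_points"
  then obtain u where u: "p \<in> int_points" "\<forall>j\<le>n. u j \<in> C" "(\<Sum>j\<le>n. u j) = 1"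
    "p = t *\<^sub>R (\<Sum>j\<le>n. u j *\<^sub>R \<alpha> j)"
    unfolding S by auto
  then show "p \<in> coef_points n \<alpha> C t"
    unfolding coef_points_def
    by (intro CollectI conjI exI [of _ "\<lambda>j. t * u j"])
      (auto intro: cone [OF t] simp: scaleR_sum_right sum_distrib_left [symmetric])
next
  fix p assume "p \<in> coef_points n \<alpha> C t"
  then obtain u where u: "p \<in> int_points" "\<forall>j\<le>n. u j \<in> C" "(\<Sum>j\<le>n. u j) = t"
    "p = (\<Sum>j\<le>n. u j *\<^sub>R \<alpha> j)"
    unfolding coef_points_def by auto
  let ?y = "\<Sum>j\<le>n. (inverse t * u j) *\<^sub>R \<alpha> j"
  have "?y \<in> S"
    unfolding S using u t
    by (intro CollectI exI [of _ "\<lambda>j. inverse t * u j"])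
      (auto intro!: cone simp: sum_distrib_left [symmetric])
  moreover have "p = t *\<^sub>R ?y"
    using u(4) t by (simp add: scaleR_sum_right mult.assoc [symmetric])
  ultimately show "p \<in> (\<lambda>x. t *\<^sub>R x) ` S \<inter> int_points"
    using u(1) by blast
qed

text \<open>Covers dilation by 0, where weights cannot be divided by \<open>t\<close>: nonnegative
  weights of sum 0 all vanish.\<close>

lemma coef_points_zero: "coef_points n \<alpha> {0..} 0 = {0}"
proof -
  have "p = 0" if p: "p \<in> coef_points n \<alpha> {0..} 0" for p
  proof -
    obtain u where u: "\<forall>j\<le>n. 0 \<le> u j" "(\<Sum>j\<le>n. u j) = 0" "p = (\<Sum>j\<le>n. u j *\<^sub>R \<alpha> j)"
      using p unfolding coef_points_def atLeast_iff by blast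
    then have "\<forall>j\<in>{..n}. u j = 0" by (subst (asm) sum_nonneg_eq_0_iff) auto
    then show ?thesis by (simp add: u(3))
  qed
  moreover have "0 \<in> coef_points n \<alpha> {0..} 0"
    by (auto simp: coef_points_def int_points_def intro!: exI [of _ "\<lambda>_. 0"])
  ultimately show ?thesis by blast
qed

theorem theorem1p4:
  fixes \<sigma> :: "(real ^ 'm) set" and \<alpha> :: "nat \<Rightarrow> real ^ 'm" and n :: nat and d :: real
  assumes "int n simplex \<sigma>"
    and "rational_polytope \<sigma>"
    and "bij_betw \<alpha> {0..n} (vertices \<sigma>)"
    and "is_denominator \<sigma> d"
  shows "(\<forall>t\<ge>0. L_closed n \<alpha> d t = real (card ((\<lambda>x. t *\<^sub>R x) ` \<sigma> \<inter> int_points))) \<and>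
         (\<forall>t>0. L_open n \<alpha> d t = real (card ((\<lambda>x. t *\<^sub>R x) ` rel_interior \<sigma> \<inter> int_points))) \<and>
         (\<forall>t. L_open n \<alpha> d (- t) = (-1) powi (aff_dim \<sigma>) * L_closed n \<alpha> d t)"
proof -
  obtain V where V: "\<not> affine_dependent V" "\<sigma> = convex hull V"
    using assms(1) by (auto simp: simplex_def)
  then have "vertices \<sigma> = V"
    by (simp add: vertices_def extreme_point_of_convex_hull_affine_independent)
  with assms(3) have inj: "inj_on \<alpha> {..n}" and img: "V = \<alpha> ` {..n}"
    by (auto simp: bij_betw_def atMost_atLeast0)
  have d: "d > 0" using assms(4) by (simp add: is_denominator_def)
  have lattice: "d *\<^sub>R \<alpha> j \<in> int_points" if "j \<le> n" for j
  proof -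
    have "\<alpha> j \<in> vertices \<sigma>" using \<open>vertices \<sigma> = V\<close> img that by auto
    \<comment> \<open>The denominator speaks of the vertices of the dilate by \<open>d\<close>;
      these include \<open>d *\<^sub>R \<alpha> j\<close> because dilation preserves
      vertices.\<close>
    then show ?thesis
      using vertices_scaleR [of d "\<alpha> j" \<sigma>] d assms(4) by (auto simp: is_denominator_def)
  qed
  have indep: "\<forall>j\<le>n. w j = 0" if "(\<Sum>j\<le>n. w j) = 0" "(\<Sum>j\<le>n. w j *\<^sub>R \<alpha> j) = 0" for w
  proof (rule ccontr)
    assume "\<not> (\<forall>j\<le>n. w j = 0)"
    \<comment> \<open>Transported to \<open>V\<close> along the inverse of \<open>\<alpha>\<close>,
      a nonzero \<open>w\<close> is an affine dependence.\<close>
    then have "affine_dependent V"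
      using that unfolding img
      by (subst affine_dependent_explicit_finite)
        (auto intro!: exI [of _ "w \<circ> inv_into {..n} \<alpha>"]
          simp: sum.reindex [OF inj] inv_into_f_f [OF inj])
    with V(1) show False ..
  qed
  have closed: "\<sigma> = {y. \<exists>u. (\<forall>j\<le>n. u j \<in> {0..}) \<and> (\<Sum>j\<le>n. u j) = 1 \<and> (\<Sum>j\<le>n. u j *\<^sub>R \<alpha> j) = y}"
    unfolding V(2) img atLeast_iff
    by (subst convex_hull_finite) (simp_all only: ex_coef_reindex [OF inj] finite_imageI finite_atMost)
  have "rel_interior \<sigma> = {y. \<exists>u. (\<forall>j\<le>n. u j \<in> {0<..}) \<and> (\<Sum>j\<le>n. u j) = 1 \<and> (\<Sum>j\<le>n. u j *\<^sub>R \<alpha> j) = y}"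
    unfolding V(2) rel_interior_convex_hull_explicit [OF V(1)] unfolding img greaterThan_iff
    by (simp only: ex_coef_reindex [OF inj])
  then have "(\<lambda>x. t *\<^sub>R x) ` rel_interior \<sigma> \<inter> int_points = coef_points n \<alpha> {0<..} t" if "t > 0" for t
    by (rule scaled_eq_coef_points) (use that in auto)
  moreover have "(\<lambda>x. t *\<^sub>R x) ` \<sigma> \<inter> int_points = coef_points n \<alpha> {0..} t" if "t \<ge> 0" for t
  proof (cases "t = 0")
    case True
    \<comment> \<open>Dilation by 0 maps a nonempty set to the single point 0.\<close>
    have "\<sigma> \<noteq> {}" using V(2) img by auto
    with True show ?thesis by (auto simp: coef_points_zero int_points_def)
  next
    case False
    with that show ?thesis by (intro scaled_eq_coef_points [OF closed]) auto
  qed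
  \<comment> \<open>\<open>aff_dim \<sigma>\<close> is \<open>int n\<close>, which turns
    \<open>powi\<close> into the natural power.\<close>
  ultimately show ?thesis
    using L_closed_eq_card [OF indep lattice d] L_open_eq_card [OF indep lattice d]
      L_open_minus [OF lattice d] aff_dim_simplex [OF assms(1)]
    by auto
qed

end
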